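(* Let $G$ be a finite group of order $v$ (written additively, not necessarily abelian) and let $A$ be a non-trivial group of automorphisms of $G$ of order $k$ such that $(G,A)$ is a Ferrero pair. Then the set of $A$-orbits on $G\setminus\{0\}$ is a disjoint $(v,k,k-1)$ difference family in $G$. If moreover $G$ is abelian and $vk$ is odd, this difference family can be partitioned into two disjoint $(v,k,\frac{k-1}{2})$ difference families.
   Context: Groups are finite and written additively but not necessarily abelian. For a subset $B$ of a group $G$, the list of differences $\Delta B$ is the multiset of all differences $b-b'$ with $b,b'\in B$, $b\neq b'$. A collection $\mathcal F$ of subsets of $G$ is a difference family of index $\lambda$ if the multiset union $\biguplus_{B\in\mathcal F}\Delta B$ covers every non-zero element of $G$ exactly $\lambda$ times; it is a $(v,k,\lambda)$ difference family if $|G|=v$ and all members (blocks) have size $k$. It is disjoint (a DDF) if its blocks are pairwise disjoint. A Ferrero pair is a pair $(G,A)$ where $A$ is a non-trivial group of automorphisms of $G$ acting semiregularly on $G\setminus\{0\}$, i.e. for $g\in G$ and $\alpha\in A$, $\alpha(g)=g$ holds only if $\alpha=\mathrm{id}_G$ or $g=0$. *)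

theory Defs
  imports
    "HOL-Library.Multiset"
    "HOL-Library.Disjoint_Sets"
    "HOL-Algebra.Group_Action"
begin

text \<open>
  The groups of HOL-Algebra are written multiplicatively: the additive \<open>b - b'\<close> is
  \<open>b \<otimes> inv b'\<close> and the zero element is \<open>\<one>\<close>. No commutativity is assumed. Groups are understood
  to be finite; for infinite \<open>B\<close> the multiset below would be empty.
\<close>

definition differences :: "('a, 'b) monoid_scheme \<Rightarrow> 'a set \<Rightarrow> 'a multiset" where
  "differences G B =
     image_mset (\<lambda>(b, b'). b \<otimes>\<^bsub>G\<^esub> inv\<^bsub>G\<^esub> b') (mset_set {(b, b'). b \<in> B \<and> b' \<in> B \<and> b \<noteq> b'})"

definition difference_family :: "('a, 'b) monoid_scheme \<Rightarrow> nat \<Rightarrow> 'a set set \<Rightarrow> bool" where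
  "difference_family G l F \<longleftrightarrow>
     F \<subseteq> Pow (carrier G) \<and>
     (\<forall>g \<in> carrier G - {\<one>\<^bsub>G\<^esub>}. count (\<Sum>B\<in>F. differences G B) g = l)"

definition vkl_difference_family ::
  "('a, 'b) monoid_scheme \<Rightarrow> nat \<Rightarrow> nat \<Rightarrow> nat \<Rightarrow> 'a set set \<Rightarrow> bool" where
  "vkl_difference_family G v k l F \<longleftrightarrow>
     difference_family G l F \<and> order G = v \<and> (\<forall>B \<in> F. card B = k)"

definition disjoint_vkl_difference_family ::
  "('a, 'b) monoid_scheme \<Rightarrow> nat \<Rightarrow> nat \<Rightarrow> nat \<Rightarrow> 'a set set \<Rightarrow> bool" where
  "disjoint_vkl_difference_family G v k l F \<longleftrightarrow> vkl_difference_family G v k l F \<and> disjoint F"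

text \<open>Elements of \<open>AutoGroup G\<close> are extensional functions on \<open>carrier G\<close>; its unit is the
  identity restricted to \<open>carrier G\<close>.\<close>

definition ferrero_pair :: "('a, 'b) monoid_scheme \<Rightarrow> ('a \<Rightarrow> 'a) set \<Rightarrow> bool" where
  "ferrero_pair G A \<longleftrightarrow>
     subgroup A (AutoGroup G) \<and>
     A \<noteq> {\<one>\<^bsub>AutoGroup G\<^esub>} \<and>
     (\<forall>\<alpha> \<in> A. \<forall>g \<in> carrier G. \<alpha> g = g \<longrightarrow> \<alpha> = \<one>\<^bsub>AutoGroup G\<^esub> \<or> g = \<one>\<^bsub>G\<^esub>)"

definition nonzero_orbits :: "('a, 'b) monoid_scheme \<Rightarrow> ('a \<Rightarrow> 'a) set \<Rightarrow> 'a set set" where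
  "nonzero_orbits G A =
     orbits (AutoGroup G\<lparr>carrier := A\<rparr>) (carrier G - {\<one>\<^bsub>G\<^esub>}) (\<lambda>\<alpha>. \<alpha>)"

end

theory Submission
  imports Defs "HOL-Algebra.Multiplicative_Group"
begin

text \<open>
  For a non-identity \<open>\<alpha> \<in> A\<close> the map sending \<open>x\<close> to \<open>\<alpha>(x) - x\<close> is injective by semiregularity,
  hence a permutation of \<open>G\<close>. So a fixed \<open>g \<noteq> 0\<close> is a difference \<open>\<alpha>(x) - x\<close> for exactly one \<open>x\<close>
  per non-identity \<open>\<alpha>\<close>, which gives \<open>k - 1\<close> representations inside the orbits.

  If \<open>G\<close> is abelian and \<open>v k\<close> is odd, then \<open>-B\<close> is an orbit different from \<open>B\<close> for every orbit \<open>B\<close>,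
  and \<open>B\<close> and \<open>-B\<close> have the same list of differences. Putting one orbit of each pair \<open>{B, -B}\<close> into
  the first family and the other into the second one halves the index.
\<close>

section \<open>Auxiliary facts: involutions, odd order and lists of differences\<close>

lemma fixpoint_free_involution_split:
  assumes closed: "\<And>B. B \<in> F \<Longrightarrow> s B \<in> F"
    and invol: "\<And>B. B \<in> F \<Longrightarrow> s (s B) = B"
    and no_fix: "\<And>B. B \<in> F \<Longrightarrow> s B \<noteq> B"
  obtains F1 where "F1 \<union> s ` F1 = F" "F1 \<inter> s ` F1 = {}"
proof -
  \<comment> \<open>The choice is made from the unordered pair \<open>{B, s B}\<close>, which is the
    same set for \<open>B\<close> and for \<open>s B\<close>. Hence \<open>c\<close> picks one
    common representative per pair, and \<open>F1\<close> will be the set of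
    representatives.\<close>
  define c where "c B = (SOME C. C \<in> {B, s B})" for B
  have c_in: "c B \<in> {B, s B}" for B
    unfolding c_def by (rule someI[of _ B]) simp
  have c_s: "c (s B) = c B" if "B \<in> F" for B
    using invol[OF that] by (simp add: c_def insert_commute)
  have c_c: "c (c B) = c B" if "B \<in> F" for B
    using c_in[of B] c_s[OF that] by auto
  show thesis
  proof (rule that)
    show "c ` F \<union> s ` c ` F = F"
    proof
      show "c ` F \<union> s ` c ` F \<subseteq> F"
        using c_in closed by (smt (verit) Un_iff image_iff insertE singletonD subsetI)
      show "F \<subseteq> c ` F \<union> s ` c ` F"
      proof
        fix B assume B: "B \<in> F"
        then have "B = c B \<or> B = s (c B)"
          using c_in[of B] invol[OF B] by auto
        then show "B \<in> c ` F \<union> s ` c ` F"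
          using B by blast
      qed
    qed
    show "c ` F \<inter> s ` c ` F = {}"
    proof (rule ccontr)
      assume "c ` F \<inter> s ` c ` F \<noteq> {}"
      then obtain B C where B: "B \<in> F" and C: "C \<in> F" and eq: "c B = s (c C)"
        by blast
      have cC: "c C \<in> F"
        using c_in[of C] C closed by auto
      \<comment> \<open>Applying \<open>c\<close> to \<open>eq\<close> shows that a representative
        which is also a partner would coincide with \<open>c C\<close>, making \<open>c C\<close> a
        fixed point of \<open>s\<close>.\<close>
      have "c B = c (c B)"
        using c_c[OF B] by simp
      also have "\<dots> = c C"
        using eq c_s[OF cC] c_c[OF C] by simp
      finally show False
        using eq no_fix[OF cC] by simp
    qed
  qed
qed

text \<open>With order 2m + 1, the power x^(2m+1) equals x because x^2 is trivial, and it equals the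
  identity by Lagrange.\<close>

lemma (in group) odd_order_square_eq_one:
  assumes "odd (order G)" "x \<in> carrier G" "x \<otimes> x = \<one>"
  shows "x = \<one>"
proof -
  obtain m where m: "order G = Suc (2 * m)"
    using assms(1) by (metis oddE Suc_eq_plus1)
  have "x [^] (2::nat) = \<one>"
    using assms by (simp add: numeral_2_eq_2)
  then have "x [^] (2 * m) = \<one>"
    using assms(2) by (metis nat_pow_pow nat_pow_one)
  then have "x [^] order G = x"
    using assms(2) m by simp
  then show ?thesis
    using pow_order_eq_1[OF assms(2)] by simp
qed

text \<open>The subtrahend determines the pair: b - x = g forces b = g + x. As g is non-zero, g + x
  differs from x, so the condition of distinctness in the list holds automatically.\<close>

lemma (in group) count_differences:
  assumes "finite B" "B \<subseteq> carrier G" "g \<in> carrier G" "g \<noteq> \<one>"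
  shows "count (differences G B) g = card {x \<in> B. g \<otimes> x \<in> B}"
proof -
  let ?P = "{(b, b'). b \<in> B \<and> b' \<in> B \<and> b \<noteq> b'}"
  let ?Q = "{p \<in> ?P. g = (\<lambda>(b, b'). b \<otimes> inv b') p}"
  have fin: "finite ?P"
    by (rule finite_subset[of _ "B \<times> B"]) (use assms(1) in auto)
  then have "count (differences G B) g = card ?Q"
    unfolding differences_def count_image_mset' by simp
  also have "\<dots> = card {x \<in> B. g \<otimes> x \<in> B}"
  proof (rule bij_betw_same_card)
    have *: "g \<otimes> b' = b" if "b \<in> B" "b' \<in> B" "g = b \<otimes> inv b'" for b b'
      using that assms by (auto simp: m_assoc subset_iff)
    have **: "g = g \<otimes> x \<otimes> inv x" if "x \<in> B" for x
      using that assms by (auto simp: m_assoc subset_iff)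
    have ***: "g \<otimes> x \<noteq> x" if "x \<in> B" for x
      using that assms by (metis r_cancel_one subsetD)
    show "bij_betw snd ?Q {x \<in> B. g \<otimes> x \<in> B}"
      by (rule bij_betw_byWitness[where f' = "\<lambda>x. (g \<otimes> x, x)"]) (use * ** *** in auto)
  qed
  finally show ?thesis .
qed

text \<open>If x and g + x lie in B, then y = -(g + x) and g + y = -x lie in -B; commutativity is
  what gives g - (g + x) = -x. The same formula also leads back from -B to B.\<close>

lemma (in comm_group) count_differences_inv_image:
  assumes "finite B" "B \<subseteq> carrier G" "g \<in> carrier G" "g \<noteq> \<one>"
  shows "count (differences G (m_inv G ` B)) g = count (differences G B) g"
proof -
  have B: "x \<in> carrier G" if "x \<in> B" for x
    using assms(2) that by blast
  have move: "g \<otimes> inv (g \<otimes> x) = inv x" if "x \<in> carrier G" for x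
    using that assms(3) by (simp add: inv_mult m_assoc[symmetric])
  have round_trip: "g \<otimes> y = x" if "x \<in> B" "y \<in> B" "g \<otimes> inv x = inv y" for x y
    using that B move[of "inv x"] by simp
  have "bij_betw (\<lambda>x. inv (g \<otimes> x)) {x \<in> B. g \<otimes> x \<in> B}
      {x \<in> m_inv G ` B. g \<otimes> x \<in> m_inv G ` B}"
    by (rule bij_betw_byWitness[where f' = "\<lambda>x. inv (g \<otimes> x)"])
      (use B assms(3) move round_trip in auto)
  then have "card {x \<in> B. g \<otimes> x \<in> B} = card {x \<in> m_inv G ` B. g \<otimes> x \<in> m_inv G ` B}"
    by (rule bij_betw_same_card)
  moreover have "m_inv G ` B \<subseteq> carrier G"
    using B by auto
  ultimately show ?thesis
    using assms by (simp add: count_differences)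
qed

section \<open>Automorphisms in a Ferrero pair\<close>

locale finite_ferrero_pair = group G for G :: "('a, 'b) monoid_scheme" (structure) +
  fixes A :: "('a \<Rightarrow> 'a) set"
  assumes finite_carrier: "finite (carrier G)"
    and ferrero: "ferrero_pair G A"
begin

abbreviation ident :: "'a \<Rightarrow> 'a" where
  "ident \<equiv> \<lambda>x\<in>carrier G. x"

abbreviation orb :: "'a \<Rightarrow> 'a set" where
  "orb x \<equiv> (\<lambda>\<alpha>. \<alpha> x) ` A"

lemma subgroup_A: "subgroup A (AutoGroup G)"
  using ferrero by (simp add: ferrero_pair_def)

lemma one_AutoGroup: "\<one>\<^bsub>AutoGroup G\<^esub> = ident"
  by (simp add: AutoGroup_def BijGroup_def)

lemma A_auto: "\<alpha> \<in> A \<Longrightarrow> \<alpha> \<in> auto G"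
  using subgroup.subset[OF subgroup_A] by (auto simp: AutoGroup_def)

lemma A_hom: "\<alpha> \<in> A \<Longrightarrow> \<alpha> \<in> hom G G"
  using A_auto unfolding auto_def by blast

lemma A_Bij: "\<alpha> \<in> A \<Longrightarrow> \<alpha> \<in> Bij (carrier G)"
  using A_auto unfolding auto_def by blast

lemma A_closed [simp]: "\<lbrakk>\<alpha> \<in> A; x \<in> carrier G\<rbrakk> \<Longrightarrow> \<alpha> x \<in> carrier G"
  by (rule hom_in_carrier[OF A_hom])

lemma A_mult: "\<lbrakk>\<alpha> \<in> A; x \<in> carrier G; y \<in> carrier G\<rbrakk> \<Longrightarrow> \<alpha> (x \<otimes> y) = \<alpha> x \<otimes> \<alpha> y"
  by (rule hom_mult[OF A_hom])

lemma A_group_hom: "\<alpha> \<in> A \<Longrightarrow> group_hom G G \<alpha>"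
  by (simp add: A_hom group_hom.intro group_hom_axioms.intro)

lemma A_inv: "\<lbrakk>\<alpha> \<in> A; x \<in> carrier G\<rbrakk> \<Longrightarrow> \<alpha> (inv x) = inv (\<alpha> x)"
  using group_hom.hom_inv[OF A_group_hom] .

lemma A_one: "\<alpha> \<in> A \<Longrightarrow> \<alpha> \<one> = \<one>"
  using group_hom.hom_one[OF A_group_hom] .

lemma A_inj: "\<lbrakk>\<alpha> \<in> A; x \<in> carrier G; y \<in> carrier G; \<alpha> x = \<alpha> y\<rbrakk> \<Longrightarrow> x = y"
  using A_Bij[of \<alpha>] by (auto simp: Bij_def bij_betw_def inj_on_def)

lemma A_ident: "ident \<in> A"
  using subgroup.one_closed[OF subgroup_A] by (simp add: one_AutoGroup)

lemma mult_AutoGroup: "\<lbrakk>\<alpha> \<in> A; \<beta> \<in> A\<rbrakk> \<Longrightarrow> \<alpha> \<otimes>\<^bsub>AutoGroup G\<^esub> \<beta> = compose (carrier G) \<alpha> \<beta>"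
  by (simp add: AutoGroup_def BijGroup_def A_Bij)

lemma A_compose: "\<lbrakk>\<alpha> \<in> A; \<beta> \<in> A\<rbrakk> \<Longrightarrow> compose (carrier G) \<alpha> \<beta> \<in> A"
  using subgroup.m_closed[OF subgroup_A] mult_AutoGroup by metis

text \<open>Turns the inverse in \<open>AutoGroup G\<close> into a pointwise left inverse on the
  carrier, the form needed to move back along orbits.\<close>

lemma A_inverse:
  assumes "\<alpha> \<in> A"
  obtains \<beta> where "\<beta> \<in> A" "\<And>x. x \<in> carrier G \<Longrightarrow> \<beta> (\<alpha> x) = x"
proof -
  let ?b = "inv\<^bsub>AutoGroup G\<^esub> \<alpha>"
  have b: "?b \<in> A"
    using subgroup.m_inv_closed[OF subgroup_A assms] .
  have "compose (carrier G) ?b \<alpha> = ident"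
    using group.l_inv[OF AutoGroup, of \<alpha>] subgroup.subset[OF subgroup_A] assms
    by (metis b mult_AutoGroup one_AutoGroup subsetD)
  then have "?b (\<alpha> x) = x" if "x \<in> carrier G" for x
    using that by (metis compose_eq restrict_apply')
  with b show thesis
    by (rule that)
qed

lemma fixed_imp_ident: "\<lbrakk>\<alpha> \<in> A; x \<in> carrier G; x \<noteq> \<one>; \<alpha> x = x\<rbrakk> \<Longrightarrow> \<alpha> = ident"
  using ferrero unfolding ferrero_pair_def one_AutoGroup by blast

text \<open>Composing \<beta> with the inverse of \<alpha> turns agreement at one non-zero point
  into a non-zero fixed point, so semiregularity makes the composite the identity. This yields both
  the size of the orbits and the injectivity in the main count.\<close>

lemma A_eqI:
  assumes "\<alpha> \<in> A" "\<beta> \<in> A" "x \<in> carrier G" "x \<noteq> \<one>" "\<alpha> x = \<beta> x"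
  shows "\<alpha> = \<beta>"
proof -
  obtain \<gamma> where g: "\<gamma> \<in> A" "\<And>x. x \<in> carrier G \<Longrightarrow> \<gamma> (\<alpha> x) = x"
    using A_inverse[OF assms(1)] by blast
  have "compose (carrier G) \<gamma> \<beta> x = x"
    using assms g by (simp add: compose_eq) (metis g(2))
  then have "compose (carrier G) \<gamma> \<beta> = ident"
    using fixed_imp_ident A_compose g(1) assms by blast
  then have *: "\<gamma> (\<beta> y) = \<gamma> (\<alpha> y)" if "y \<in> carrier G" for y
    using that g(2) by (metis compose_eq restrict_apply')
  show ?thesis
  proof (rule extensionalityI)
    show "\<alpha> \<in> extensional (carrier G)" "\<beta> \<in> extensional (carrier G)"
      using A_Bij assms Bij_imp_extensional by blast+
    show "\<alpha> y = \<beta> y" if "y \<in> carrier G" for y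
      using * that g(1) assms by (metis A_inj A_closed)
  qed
qed

section \<open>Orbits on the non-zero elements\<close>

lemma nonzero_orbits_eq: "nonzero_orbits G A = orb ` (carrier G - {\<one>})"
  by (auto simp: nonzero_orbits_def orbits_def orbit_def)

lemma orb_refl: "x \<in> carrier G \<Longrightarrow> x \<in> orb x"
  using A_ident by (metis (no_types, lifting) image_eqI restrict_apply')

lemma orb_subset:
  assumes "x \<in> carrier G" "y \<in> orb x"
  shows "orb y \<subseteq> orb x"
proof -
  obtain \<alpha> where a: "\<alpha> \<in> A" "y = \<alpha> x"
    using assms by blast
  have "\<beta> y \<in> orb x" if "\<beta> \<in> A" for \<beta>
    using A_compose[OF that a(1)] a(2) assms(1)
    by (metis (no_types, lifting) compose_eq image_eqI)
  then show ?thesis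
    by blast
qed

text \<open>The inverse automorphism puts x back into \<open>orb y\<close>, so
  \<open>orb_subset\<close> applies in both directions.\<close>

lemma orb_eq:
  assumes "x \<in> carrier G" "y \<in> orb x"
  shows "orb y = orb x"
proof -
  obtain \<alpha> where a: "\<alpha> \<in> A" "y = \<alpha> x"
    using assms by blast
  obtain \<beta> where "\<beta> \<in> A" "\<And>x. x \<in> carrier G \<Longrightarrow> \<beta> (\<alpha> x) = x"
    using A_inverse[OF a(1)] by blast
  then have "x \<in> orb y"
    using a assms(1) by (metis (no_types, lifting) image_eqI)
  moreover have "y \<in> carrier G"
    using a assms by simp
  ultimately show ?thesis
    using orb_subset assms by blast
qed

lemma orb_nonzero: "x \<in> carrier G - {\<one>} \<Longrightarrow> orb x \<subseteq> carrier G - {\<one>}"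
proof
  fix y assume x: "x \<in> carrier G - {\<one>}" and "y \<in> orb x"
  then obtain \<alpha> where a: "\<alpha> \<in> A" "y = \<alpha> x"
    by blast
  then have "y \<noteq> \<one>"
    using A_inj[OF a(1), of x \<one>] A_one[OF a(1)] x by auto
  then show "y \<in> carrier G - {\<one>}"
    using a x by simp
qed

lemma nonzero_orbits_subset: "B \<in> nonzero_orbits G A \<Longrightarrow> B \<subseteq> carrier G - {\<one>}"
  using orb_nonzero unfolding nonzero_orbits_eq by blast

lemma nonzero_orbit_eq_orb: "\<lbrakk>B \<in> nonzero_orbits G A; x \<in> B\<rbrakk> \<Longrightarrow> B = orb x"
  unfolding nonzero_orbits_eq using orb_eq by blast

lemma disjoint_nonzero_orbits: "disjoint (nonzero_orbits G A)"
  using nonzero_orbit_eq_orb by (intro disjointI) blast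

lemma finite_nonzero_orbits: "finite (nonzero_orbits G A)"
  by (simp add: nonzero_orbits_eq finite_carrier)

text \<open>Non-triviality of A enters here: without non-zero elements the identity would be the
  only automorphism. The result later keeps both halves of the partition non-empty.\<close>

lemma nonzero_orbits_nonempty: "nonzero_orbits G A \<noteq> {}"
proof
  assume "nonzero_orbits G A = {}"
  then have c: "carrier G = {\<one>}"
    unfolding nonzero_orbits_eq by blast
  have "\<alpha> = ident" if "\<alpha> \<in> A" for \<alpha>
  proof (rule extensionalityI)
    show "\<alpha> \<in> extensional (carrier G)"
      using A_Bij that Bij_imp_extensional by blast
    show "\<alpha> x = ident x" if "x \<in> carrier G" for x
      using that c A_one[OF \<open>\<alpha> \<in> A\<close>] by auto
  qed simp
  then have "A = {\<one>\<^bsub>AutoGroup G\<^esub>}"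
    unfolding one_AutoGroup using A_ident by blast
  then show False
    using ferrero by (simp add: ferrero_pair_def)
qed

lemma card_nonzero_orbit: "B \<in> nonzero_orbits G A \<Longrightarrow> card B = card A"
proof -
  assume "B \<in> nonzero_orbits G A"
  then obtain x where x: "x \<in> carrier G" "x \<noteq> \<one>" "B = orb x"
    unfolding nonzero_orbits_eq by blast
  \<comment> \<open>Semiregularity: an element of A is determined by its value at the non-zero point
    x.\<close>
  have "inj_on (\<lambda>\<alpha>. \<alpha> x) A"
    using A_eqI x by (intro inj_onI) blast
  then show ?thesis
    unfolding x(3) by (rule card_image)
qed

lemma finite_A: "finite A"
proof -
  have "A \<subseteq> carrier G \<rightarrow>\<^sub>E carrier G"
    using A_Bij Bij_imp_extensional by (auto simp: PiE_def)
  then show ?thesis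
    using finite_PiE[of "carrier G" "\<lambda>_. carrier G"] finite_carrier
    by (meson finite_subset)
qed

section \<open>Counting differences over all orbits\<close>

lemma bij_displacement:
  assumes "\<alpha> \<in> A" "\<alpha> \<noteq> ident"
  shows "bij_betw (\<lambda>x. \<alpha> x \<otimes> inv x) (carrier G) (carrier G)"
proof -
  have "inj_on (\<lambda>x. \<alpha> x \<otimes> inv x) (carrier G)"
  proof (rule inj_onI)
    fix x y
    assume x: "x \<in> carrier G" and y: "y \<in> carrier G"
      and eq: "\<alpha> x \<otimes> inv x = \<alpha> y \<otimes> inv y"
    have "\<alpha> x = \<alpha> y \<otimes> inv y \<otimes> x"
      using inv_solve_right'[of "\<alpha> y \<otimes> inv y" "\<alpha> x" x] x y assms(1) eq by simp
    \<comment> \<open>Equal displacements read \<alpha>(x) = \<alpha>(y) - y + x, so -\<alpha>(y) +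
      \<alpha>(x) = -y + x. The order of the terms matters, as G need not be abelian.\<close>
    then have "\<alpha> (inv y \<otimes> x) = inv y \<otimes> x"
      using x y assms(1) by (simp add: A_mult A_inv m_assoc[symmetric])
    then have "inv y \<otimes> x = \<one>"
      using fixed_imp_ident[OF assms(1), of "inv y \<otimes> x"] assms(2) x y by auto
    then show "x = y"
      using x y by (metis inv_equality inv_inv inv_closed)
  qed
  moreover have "(\<lambda>x. \<alpha> x \<otimes> inv x) ` carrier G \<subseteq> carrier G"
    using assms(1) by auto
  ultimately show ?thesis
    using finite_carrier by (simp add: bij_betw_def endo_inj_surj)
qed

text \<open>Summed over the orbits, the count is the number of non-zero x for which g + x lies in
  the orbit of x. Each such x belongs to exactly one \<alpha> in A with \<alpha>(x) = g + x, and
  every \<alpha> except the identity occurs.\<close>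

lemma count_nonzero_orbits:
  assumes g: "g \<in> carrier G" "g \<noteq> \<one>"
  shows "count (\<Sum>B\<in>nonzero_orbits G A. differences G B) g = card A - 1"
proof -
  let ?X = "\<lambda>B. {x \<in> B. g \<otimes> x \<in> B}"
  let ?U = "{x \<in> carrier G - {\<one>}. g \<otimes> x \<in> orb x}"
  have sub: "B \<subseteq> carrier G" if "B \<in> nonzero_orbits G A" for B
    using nonzero_orbits_subset that by blast
  have fin: "finite B" if "B \<in> nonzero_orbits G A" for B
    using sub that finite_carrier finite_subset by blast
  have "count (\<Sum>B\<in>nonzero_orbits G A. differences G B) g
      = (\<Sum>B\<in>nonzero_orbits G A. card (?X B))"
    unfolding count_sum using sub fin g by (intro sum.cong) (auto simp: count_differences)
  \<comment> \<open>The sets are disjoint because an element x determines its orbit.\<close>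
  also have "\<dots> = card (\<Union>B\<in>nonzero_orbits G A. ?X B)"
  proof (rule card_UN_disjoint[symmetric])
    show "finite (nonzero_orbits G A)"
      by (rule finite_nonzero_orbits)
    show "\<forall>B\<in>nonzero_orbits G A. finite (?X B)"
      using fin by simp
    show "\<forall>B\<in>nonzero_orbits G A. \<forall>C\<in>nonzero_orbits G A. B \<noteq> C \<longrightarrow> ?X B \<inter> ?X C = {}"
      using nonzero_orbit_eq_orb by blast
  qed
  also have "(\<Union>B\<in>nonzero_orbits G A. ?X B) = ?U"
  proof
    show "(\<Union>B\<in>nonzero_orbits G A. ?X B) \<subseteq> ?U"
      using nonzero_orbit_eq_orb nonzero_orbits_subset by blast
    show "?U \<subseteq> (\<Union>B\<in>nonzero_orbits G A. ?X B)"
      using orb_refl unfolding nonzero_orbits_eq by blast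
  qed
  also have "card ?U = card (A - {ident})"
  proof -
    \<comment> \<open>\<open>f \<alpha>\<close> solves \<alpha>(x) - x = g; for non-identity
      \<alpha> the solution exists and is unique by \<open>bij_displacement\<close>. It is non-zero
      since zero has displacement zero.\<close>
    define f where "f \<alpha> = inv_into (carrier G) (\<lambda>x. \<alpha> x \<otimes> inv x) g" for \<alpha>
    have f: "f \<alpha> \<in> carrier G" "f \<alpha> \<noteq> \<one>" "\<alpha> (f \<alpha>) = g \<otimes> f \<alpha>" if "\<alpha> \<in> A - {ident}" for \<alpha>
    proof -
      have g_in: "g \<in> (\<lambda>x. \<alpha> x \<otimes> inv x) ` carrier G"
        using bij_displacement[of \<alpha>] that g(1) by (simp add: bij_betw_def)
      show c: "f \<alpha> \<in> carrier G"
        unfolding f_def using inv_into_into[OF g_in] .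
      have eq: "\<alpha> (f \<alpha>) \<otimes> inv (f \<alpha>) = g"
        unfolding f_def using f_inv_into_f[OF g_in] .
      then show "\<alpha> (f \<alpha>) = g \<otimes> f \<alpha>"
        using c that g(1) by (auto simp: m_assoc)
      show "f \<alpha> \<noteq> \<one>"
        using eq g(2) that A_one by auto
    qed
    have "bij_betw f (A - {ident}) ?U"
    proof (rule bij_betw_imageI)
      show "inj_on f (A - {ident})"
      proof (rule inj_onI)
        fix \<alpha> \<beta> assume "\<alpha> \<in> A - {ident}" "\<beta> \<in> A - {ident}" "f \<alpha> = f \<beta>"
        then show "\<alpha> = \<beta>"
          using f[of \<alpha>] f[of \<beta>] A_eqI[of \<alpha> \<beta> "f \<alpha>"] by simp
      qed
      show "f ` (A - {ident}) = ?U"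
      proof
        show "f ` (A - {ident}) \<subseteq> ?U"
        proof
          fix x assume "x \<in> f ` (A - {ident})"
          then obtain \<alpha> where a: "\<alpha> \<in> A - {ident}" "x = f \<alpha>"
            by blast
          then have "g \<otimes> x \<in> orb x"
            using f(3)[OF a(1)] by (metis (no_types, lifting) DiffD1 image_eqI)
          then show "x \<in> ?U"
            using f(1,2)[OF a(1)] unfolding a(2) by simp
        qed
        show "?U \<subseteq> f ` (A - {ident})"
        proof
          fix x assume x: "x \<in> ?U"
          then obtain \<alpha> where a: "\<alpha> \<in> A" "g \<otimes> x = \<alpha> x" and xc: "x \<in> carrier G"
            by blast
          have "\<alpha> \<noteq> ident"
          proof
            assume "\<alpha> = ident"
            then have "g \<otimes> x = x"
              using a xc by simp
            then show False
              using xc g by simp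
          qed
          moreover have "\<alpha> x \<otimes> inv x = g"
            using a(2)[symmetric] xc g(1) by (simp add: m_assoc)
          ultimately have "f \<alpha> = x"
            unfolding f_def using bij_displacement[OF a(1)] xc
            by (auto simp: bij_betw_def intro: inv_into_f_eq)
          then show "x \<in> f ` (A - {ident})"
            using a(1) \<open>\<alpha> \<noteq> ident\<close> by blast
        qed
      qed
    qed
    then show ?thesis
      by (rule bij_betw_same_card[symmetric])
  qed
  also have "\<dots> = card A - 1"
    using A_ident finite_A by simp
  finally show ?thesis .
qed

lemma disjoint_difference_family_nonzero_orbits:
  "disjoint_vkl_difference_family G (order G) (card A) (card A - 1) (nonzero_orbits G A)"
  unfolding disjoint_vkl_difference_family_def vkl_difference_family_def difference_family_def
  using nonzero_orbits_subset count_nonzero_orbits card_nonzero_orbit disjoint_nonzero_orbits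
  by blast

section \<open>Inversion of orbits and the partition into two families\<close>

lemma inv_image_orb: "x \<in> carrier G \<Longrightarrow> m_inv G ` orb x = orb (inv x)"
  unfolding image_image by (rule image_cong) (simp_all add: A_inv)

lemma inv_image_nonzero_orbit:
  "B \<in> nonzero_orbits G A \<Longrightarrow> m_inv G ` B \<in> nonzero_orbits G A"
proof -
  assume "B \<in> nonzero_orbits G A"
  then obtain x where x: "x \<in> carrier G - {\<one>}" "B = orb x"
    unfolding nonzero_orbits_eq by blast
  then have "m_inv G ` B = orb (inv x)" "inv x \<in> carrier G - {\<one>}"
    using inv_image_orb by auto
  then show ?thesis
    unfolding nonzero_orbits_eq by blast
qed

text \<open>If -B = B, some \<alpha> in A sends a point x of B to -x, so \<alpha> composed with
  itself fixes x and is the identity. Odd order of A forces \<alpha> to be the identity; then x + x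
  = 0, and odd order of G forces x = 0.\<close>

lemma inv_image_nonzero_orbit_neq:
  assumes odd: "odd (order G)" "odd (card A)" and B: "B \<in> nonzero_orbits G A"
  shows "m_inv G ` B \<noteq> B"
proof
  assume eq: "m_inv G ` B = B"
  obtain x where x: "x \<in> carrier G" "x \<noteq> \<one>" "B = orb x"
    using B by (auto simp: nonzero_orbits_eq)
  have "inv x \<in> B"
    using eq orb_refl[OF x(1)] x(3) by blast
  then obtain \<alpha> where a: "\<alpha> \<in> A" "\<alpha> x = inv x"
    using x(3) by auto
  have "compose (carrier G) \<alpha> \<alpha> x = x"
    using a x by (simp add: compose_eq A_inv)
  then have sq: "compose (carrier G) \<alpha> \<alpha> = ident"
    using fixed_imp_ident A_compose a(1) x by blast
  \<comment> \<open>A is made a group of its own, so that \<open>odd_order_square_eq_one\<close> can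
    be used with \<open>card A\<close> as the order.\<close>
  interpret H: group "AutoGroup G\<lparr>carrier := A\<rparr>"
    using subgroup.subgroup_is_group[OF subgroup_A AutoGroup] .
  have "\<alpha> = ident"
    using H.odd_order_square_eq_one[of \<alpha>] odd(2) a(1) sq
    by (simp add: order_def mult_AutoGroup one_AutoGroup)
  then have "x \<otimes> x = \<one>"
    using a(2) x(1) by (metis restrict_apply' r_inv)
  then show False
    using odd_order_square_eq_one[OF odd(1)] x by blast
qed

lemma split_nonzero_orbits:
  assumes comm: "comm_group G" and odd: "odd (order G)" "odd (card A)"
  obtains F1 F2 where "F1 \<noteq> {}" "F2 \<noteq> {}"
    "F1 \<union> F2 = nonzero_orbits G A" "F1 \<inter> F2 = {}"
    "disjoint_vkl_difference_family G (order G) (card A) ((card A - 1) div 2) F1"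
    "disjoint_vkl_difference_family G (order G) (card A) ((card A - 1) div 2) F2"
proof -
  interpret comm_group G
    by (rule comm)
  let ?F = "nonzero_orbits G A"
  let ?s = "\<lambda>B. m_inv G ` B"
  have sub: "B \<subseteq> carrier G" if "B \<in> ?F" for B
    using nonzero_orbits_subset that by blast
  have fin: "finite B" if "B \<in> ?F" for B
    using sub that finite_carrier finite_subset by blast
  have invol: "?s (?s B) = B" if "B \<in> ?F" for B
  proof -
    have "inv (inv x) = x" if "x \<in> B" for x
      using that sub[OF \<open>B \<in> ?F\<close>] by auto
    then show ?thesis
      by (simp add: image_image)
  qed
  obtain F1 where F1: "F1 \<union> ?s ` F1 = ?F" "F1 \<inter> ?s ` F1 = {}"
    using fixpoint_free_involution_split[of ?F ?s] inv_image_nonzero_orbit invol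
      inv_image_nonzero_orbit_neq[OF odd] by metis
  define F2 where "F2 = ?s ` F1"
  have F: "F1 \<subseteq> ?F" "F2 \<subseteq> ?F"
    using F1 F2_def by auto
  have finF: "finite F1" "finite F2"
    using F finite_nonzero_orbits finite_subset by blast+
  let ?c = "\<lambda>F g. count (\<Sum>B\<in>F. differences G B) g"
  have count: "?c F1 g = (card A - 1) div 2 \<and> ?c F2 g = (card A - 1) div 2"
    if g: "g \<in> carrier G" "g \<noteq> \<one>" for g
  proof -
    \<comment> \<open>Injectivity allows the sum over \<open>F2\<close> to be reindexed by
      \<open>F1\<close>, where it is compared block by block.\<close>
    have "inj_on ?s F1"
      using invol F(1) by (intro inj_on_inverseI[where g = ?s]) blast
    then have "?c F2 g = (\<Sum>B\<in>F1. count (differences G (?s B)) g)"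
      by (simp add: F2_def count_sum sum.reindex)
    also have "\<dots> = ?c F1 g"
      unfolding count_sum using F(1) sub fin g
      by (intro sum.cong) (auto intro!: count_differences_inv_image)
    finally have same: "?c F2 g = ?c F1 g" .
    \<comment> \<open>The two counts are equal and add up to \<open>card A - 1\<close>, so each is
      exactly half of it.\<close>
    have "?c F1 g + ?c F2 g = ?c ?F g"
      using F1 finF by (simp add: F2_def[symmetric] sum.union_disjoint flip: F1(1))
    then show ?thesis
      using same count_nonzero_orbits[OF g] by simp
  qed
  have fam: "disjoint_vkl_difference_family G (order G) (card A) ((card A - 1) div 2) F'"
    if "F' = F1 \<or> F' = F2" for F'
  proof -
    have "F' \<subseteq> ?F"
      using that F by blast
    moreover have "?c F' g = (card A - 1) div 2" if "g \<in> carrier G - {\<one>}" for g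
      using count[of g] that \<open>F' = F1 \<or> F' = F2\<close> by auto
    moreover have "disjoint F'"
      using \<open>F' \<subseteq> ?F\<close> disjoint_nonzero_orbits by (rule pairwise_subset[rotated])
    ultimately show ?thesis
      unfolding disjoint_vkl_difference_family_def vkl_difference_family_def
        difference_family_def
      using sub card_nonzero_orbit by blast
  qed
  \<comment> \<open>An empty \<open>F1\<close> would have an empty image too, leaving no orbits at
    all; \<open>F2\<close>, as the image of \<open>F1\<close>, is then non-empty as well.\<close>
  have "F1 \<noteq> {}"
    using F1(1) nonzero_orbits_nonempty by auto
  then show thesis
    using that[of F1 F2] F1 fam F2_def by blast
qed

end

theorem theorem1:
  fixes G :: "('a, 'b) monoid_scheme" and A :: "('a \<Rightarrow> 'a) set" and v k :: nat
  assumes "group G" and "finite (carrier G)" and "order G = v"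
    and "ferrero_pair G A" and "card A = k"
  shows "disjoint_vkl_difference_family G v k (k - 1) (nonzero_orbits G A) \<and>
    (comm_group G \<and> odd (v * k) \<longrightarrow>
      (\<exists>F1 F2. F1 \<noteq> {} \<and> F2 \<noteq> {} \<and>
        F1 \<union> F2 = nonzero_orbits G A \<and> F1 \<inter> F2 = {} \<and>
        disjoint_vkl_difference_family G v k ((k - 1) div 2) F1 \<and>
        disjoint_vkl_difference_family G v k ((k - 1) div 2) F2))"
proof -
  interpret finite_ferrero_pair G A
    using assms by (simp add: finite_ferrero_pair.intro finite_ferrero_pair_axioms.intro)
  show ?thesis
  proof (intro conjI impI)
    show "disjoint_vkl_difference_family G v k (k - 1) (nonzero_orbits G A)"
      using disjoint_difference_family_nonzero_orbits assms(3,5) by simp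
    assume "comm_group G \<and> odd (v * k)"
    then obtain F1 F2 where "F1 \<noteq> {}" "F2 \<noteq> {}"
      "F1 \<union> F2 = nonzero_orbits G A" "F1 \<inter> F2 = {}"
      "disjoint_vkl_difference_family G v k ((k - 1) div 2) F1"
      "disjoint_vkl_difference_family G v k ((k - 1) div 2) F2"
      using split_nonzero_orbits[unfolded assms(3,5)] by auto
    then show "\<exists>F1 F2. F1 \<noteq> {} \<and> F2 \<noteq> {} \<and>
        F1 \<union> F2 = nonzero_orbits G A \<and> F1 \<inter> F2 = {} \<and>
        disjoint_vkl_difference_family G v k ((k - 1) div 2) F1 \<and>
        disjoint_vkl_difference_family G v k ((k - 1) div 2) F2"
      by blast
  qed
qed

end
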